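(* Let $p,q\in(1,\infty)$. Then: (1) The inequality $$\sin_{p,q}(\sqrt{rs})\geq \sqrt{\sin_{p,q}(r)\,\sin_{p,q}(s)}$$ holds for all $r,s\in(0,\pi_{p,q}/2)$. (2) The inequality $$\sinh_{p,q}(\sqrt{r^*s^*})\leq \sqrt{\sinh_{p,q}(r^* )\,\sinh_{p,q}(s^* )}$$ holds for all $r^*,s^*\in(0,m^*_{p,q})$.
   Context: For real $p,q>1$, define $\arcsin_{p,q}(x)=\int_0^x(1-t^q)^{-1/p}\,dt$ for $x\in[0,1]$ and $\frac{\pi_{p,q}}{2}=\int_0^1(1-t^q)^{-1/p}\,dt$ (a finite number). Then $\arcsin_{p,q}:[0,1]\to[0,\pi_{p,q}/2]$ is an increasing homeomorphism, and $\sin_{p,q}:[0,\pi_{p,q}/2]\to[0,1]$ denotes its inverse. Define $\mathrm{arcsinh}_{p,q}(x)=\int_0^x(1+t^q)^{-1/p}\,dt$ for $x\in(0,\infty)$ and $m^*_{p,q}=\int_0^\infty(1+t^q)^{-1/p}\,dt\in(0,+\infty]$ (the value is $+\infty$ exactly when $p\ge q$). The function $\sinh_{p,q}:(0,m^*_{p,q})\to(0,\infty)$ denotes the inverse of $\mathrm{arcsinh}_{p,q}$. *)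

theory Defs
  imports "HOL-Analysis.Analysis"
begin

text \<open>The integrand of \<open>arcsin_pq\<close> is unbounded at \<open>t = 1\<close>; the gauge integral over \<open>{0..1}\<close> is the
  improper integral, the value \<open>0 powr _ = 0\<close> at the single point \<open>t = 1\<close> being irrelevant.\<close>

definition arcsin_pq :: "real \<Rightarrow> real \<Rightarrow> real \<Rightarrow> real" where
  "arcsin_pq p q x = integral {0..x} (\<lambda>t. (1 - t powr q) powr (- (1 / p)))"

definition pi_pq :: "real \<Rightarrow> real \<Rightarrow> real" where
  "pi_pq p q = 2 * integral {0..1} (\<lambda>t. (1 - t powr q) powr (- (1 / p)))"

text \<open>Only meaningful for arguments in \<open>{0..pi_pq p q / 2}\<close>.\<close>

definition sin_pq :: "real \<Rightarrow> real \<Rightarrow> real \<Rightarrow> real" where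
  "sin_pq p q = the_inv_into {0..1} (arcsin_pq p q)"

definition arcsinh_pq :: "real \<Rightarrow> real \<Rightarrow> real \<Rightarrow> real" where
  "arcsinh_pq p q x = integral {0..x} (\<lambda>t. (1 + t powr q) powr (- (1 / p)))"

text \<open>Extended-real valued, since the integral diverges when \<open>p \<ge> q\<close>.\<close>

definition mstar_pq :: "real \<Rightarrow> real \<Rightarrow> ennreal" where
  "mstar_pq p q = (\<integral>\<^sup>+t\<in>{0..}. ennreal ((1 + t powr q) powr (- (1 / p))) \<partial>lborel)"

text \<open>Only meaningful for arguments strictly between \<open>0\<close> and \<open>mstar_pq p q\<close>.\<close>

definition sinh_pq :: "real \<Rightarrow> real \<Rightarrow> real \<Rightarrow> real" where
  "sinh_pq p q = the_inv_into {0<..} (arcsinh_pq p q)"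

end

theory Submission
  imports Defs
begin

text \<open>
  Write \<open>F(x)\<close> for the integral of \<open>f\<close> over \<open>{0..x}\<close>, where \<open>f\<close> is one of the integrands
  \<open>(1 - t\<^sup>q)\<close> or \<open>(1 + t\<^sup>q)\<close> to the power \<open>-1/p\<close>. The inequalities for the inverse functions say
  that \<open>log F\<close> is midpoint convex, respectively midpoint concave, as a function of \<open>log x\<close>:
  for \<open>z = sqrt (x * y)\<close> one has \<open>F(z)\<^sup>2 \<le> F(x) F(y)\<close> for the arcsine and the reverse for the
  hyperbolic arcsine.

  Let \<open>x \<le> y\<close> and \<open>l = y / z = z / x\<close>, so \<open>l \<ge> 1\<close>. The claim compares the quotients
  \<open>F(l x) / F(x)\<close> and \<open>F(l z) / F(z)\<close>. After the substitution \<open>t \<mapsto> l t\<close>, the quotient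
  \<open>F(l x) / F(x)\<close> becomes \<open>l\<close> times the quotient of the integrals of \<open>f(l t)\<close> and of \<open>f(t)\<close> over
  \<open>{0..x}\<close>, which is \<open>l\<close> times the mean of \<open>f(l t) / f(t)\<close> with respect to the weight \<open>f\<close>. A mean
  over \<open>{0..x}\<close> of a monotone function is monotone in \<open>x\<close> (\<open>integral_ratio_decreasing\<close>), so it
  suffices that \<open>f(l t) / f(t)\<close> is monotone in \<open>t\<close>. With \<open>T = t\<^sup>q\<close> and \<open>L = l\<^sup>q \<ge> 1\<close> the relevant
  quotients are \<open>(1 - L T) / (1 - T)\<close> and \<open>(1 + L T) / (1 + T)\<close>, the first decreasing and the second
  increasing in \<open>T\<close>; the exponent \<open>-1/p\<close> reverses the two directions.

  Since \<open>F\<close> is strictly increasing and continuous, the inequalities pass to the inverse functions.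
\<close>

section \<open>Ratios of integrals\<close>

text \<open>The quotient of the integrals of \<open>g\<close> and \<open>f\<close> is the mean of \<open>g / f\<close> with weight \<open>f\<close>. If
  \<open>g / f\<close> decreases, its mean over \<open>{0..x}\<close> is at least the value at \<open>x\<close>, and enlarging the
  interval to \<open>{0..z}\<close> only adds values not above that one. Cross-multiplied forms
  avoid all divisions.\<close>

lemma integral_ratio_decreasing:
  fixes f g :: "real \<Rightarrow> real"
  assumes cf: "continuous_on {0..z} f" and cg: "continuous_on {0..z} g"
    and f0: "\<And>t. 0 \<le> t \<Longrightarrow> t \<le> z \<Longrightarrow> 0 < f t"
    and g0: "\<And>t. 0 \<le> t \<Longrightarrow> t \<le> z \<Longrightarrow> 0 \<le> g t"
    and dec: "\<And>s t. 0 \<le> s \<Longrightarrow> s \<le> t \<Longrightarrow> t \<le> z \<Longrightarrow> g t * f s \<le> g s * f t"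
    and x: "0 \<le> x" "x \<le> z"
  shows "integral {0..z} g * integral {0..x} f \<le> integral {0..x} g * integral {0..z} f"
proof -
  have intf: "f integrable_on {0..z}" "f integrable_on {0..x}" "f integrable_on {x..z}"
    and intg: "g integrable_on {0..z}" "g integrable_on {0..x}" "g integrable_on {x..z}"
    using x by (auto intro!: integrable_continuous_real continuous_on_subset[OF cf]
        continuous_on_subset[OF cg])
  define A A' where "A = integral {0..x} g" and "A' = integral {x..z} g"
  define B B' where "B = integral {0..x} f" and "B' = integral {x..z} f"
  have "integral {0..x} (\<lambda>t. g x * f t) \<le> integral {0..x} (\<lambda>t. f x * g t)"
    using x dec[of _ x] intf intg
    by (intro integral_le integrable_on_mult_right) (auto simp: mult.commute)
  hence 1: "g x * B \<le> f x * A"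
    by (simp add: A_def B_def)
  have "integral {x..z} (\<lambda>t. f x * g t) \<le> integral {x..z} (\<lambda>t. g x * f t)"
    using x dec[of x] intf intg
    by (intro integral_le integrable_on_mult_right) (auto simp: mult.commute)
  hence 2: "f x * A' \<le> g x * B'"
    by (simp add: A'_def B'_def)
  have B: "0 \<le> B" "0 \<le> B'"
    unfolding B_def B'_def using x by (auto intro!: integral_nonneg intf less_imp_le[OF f0])
  have "f x * (A' * B) \<le> g x * B' * B"
    using mult_right_mono[OF 2 B(1)] by (simp add: mult_ac)
  also have "\<dots> \<le> f x * (A * B')"
    using mult_right_mono[OF 1 B(2)] by (simp add: mult_ac)
  finally have "A' * B \<le> A * B'"
    using f0[OF x] by simp
  moreover have "integral {0..z} g = A + A'" "integral {0..z} f = B + B'"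
    unfolding A_def A'_def B_def B'_def using x intf intg
    by (auto simp: Henstock_Kurzweil_Integration.integral_combine)
  ultimately show ?thesis
    by (simp add: A_def[symmetric] B_def[symmetric] algebra_simps)
qed

lemma integral_scaled:
  fixes f :: "real \<Rightarrow> real"
  assumes "0 < l"
  shows "integral {0..x} (\<lambda>t. f (l * t)) = integral {0..l * x} f / l"
  using integral_stretch_real[of l 0 "l * x" f] assms by (simp add: image_divide_atLeastAtMost)

text \<open>Passing from \<open>f(t)\<close> to \<open>f(l t)\<close> with \<open>l = y / z = z / x\<close> turns the integral up to \<open>x\<close> into the
  one up to \<open>z\<close>, and the integral up to \<open>z\<close> into the one up to \<open>y\<close>, both divided by \<open>l\<close>.\<close>

lemma geometric_mean_scaling:
  fixes x y :: real
  assumes "0 < x" "x \<le> y"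
  obtains l where "1 \<le> l" "l * x = sqrt (x * y)" "l * sqrt (x * y) = y"
    "x \<le> sqrt (x * y)" "sqrt (x * y) \<le> y"
proof
  have y: "0 < y" using assms by simp
  show "1 \<le> sqrt (y / x)" using assms by simp
  have "x = sqrt x * sqrt x" "y = sqrt y * sqrt y" using assms y by simp_all
  then show "sqrt (y / x) * x = sqrt (x * y)" "sqrt (y / x) * sqrt (x * y) = y"
    using assms y by (simp_all add: real_sqrt_divide real_sqrt_mult field_simps)
  show "x \<le> sqrt (x * y)" "sqrt (x * y) \<le> y"
    using assms y by (auto intro!: real_le_rsqrt real_le_lsqrt simp: power2_eq_square)
qed

lemma integral_geometric_mean_ge:
  fixes f :: "real \<Rightarrow> real"
  assumes cf: "continuous_on {0..b} f"
    and f0: "\<And>t. 0 \<le> t \<Longrightarrow> t \<le> b \<Longrightarrow> 0 < f t"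
    and dec: "\<And>l s t. 1 \<le> l \<Longrightarrow> 0 \<le> s \<Longrightarrow> s \<le> t \<Longrightarrow> l * t \<le> b \<Longrightarrow>
      f (l * t) * f s \<le> f (l * s) * f t"
    and xy: "0 < x" "x \<le> b" "0 < y" "y \<le> b"
  shows "integral {0..x} f * integral {0..y} f \<le> (integral {0..sqrt (x * y)} f)\<^sup>2"
  using xy
proof (induction x y rule: linorder_wlog)
  case (le x y)
  then obtain l where l: "1 \<le> l" "l * x = sqrt (x * y)" "l * sqrt (x * y) = y"
    "x \<le> sqrt (x * y)" "sqrt (x * y) \<le> y"
    using geometric_mean_scaling by blast
  define z where "z = sqrt (x * y)"
  note l = l[folded z_def]
  have bound: "0 \<le> l * t" "l * t \<le> b" "t \<le> b" if "0 \<le> t" "t \<le> z" for t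
    using that l le mult_left_mono[of t z l] by auto
  have scaled: "integral {0..x} (\<lambda>t. f (l * t)) = integral {0..z} f / l"
    "integral {0..z} (\<lambda>t. f (l * t)) = integral {0..y} f / l"
    using l by (simp_all add: integral_scaled)
  have "integral {0..z} (\<lambda>t. f (l * t)) * integral {0..x} f
      \<le> integral {0..x} (\<lambda>t. f (l * t)) * integral {0..z} f"
  proof (rule integral_ratio_decreasing)
    show "continuous_on {0..z} f"
      by (rule continuous_on_subset[OF cf]) (use bound in auto)
    show "continuous_on {0..z} (\<lambda>t. f (l * t))"
      using bound by (intro continuous_on_compose2[OF cf]) (auto intro!: continuous_intros)
    show "f (l * t) * f s \<le> f (l * s) * f t" if "0 \<le> s" "s \<le> t" "t \<le> z" for s t
      using dec[OF l(1) that(1,2)] bound[of t] that by linarith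
  qed (use l le f0 bound in \<open>auto simp: less_imp_le\<close>)
  then have "integral {0..x} f * integral {0..y} f / l \<le> (integral {0..z} f)\<^sup>2 / l"
    unfolding scaled by (simp add: power2_eq_square mult.commute)
  then show ?case
    using l by (simp add: z_def[symmetric] divide_le_cancel)
next
  case (sym x y)
  then show ?case by (simp add: mult.commute)
qed

lemma integral_geometric_mean_le:
  fixes f :: "real \<Rightarrow> real"
  assumes cf: "continuous_on {0..b} f"
    and f0: "\<And>t. 0 \<le> t \<Longrightarrow> t \<le> b \<Longrightarrow> 0 < f t"
    and inc: "\<And>l s t. 1 \<le> l \<Longrightarrow> 0 \<le> s \<Longrightarrow> s \<le> t \<Longrightarrow> l * t \<le> b \<Longrightarrow>
      f (l * s) * f t \<le> f (l * t) * f s"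
    and xy: "0 < x" "x \<le> b" "0 < y" "y \<le> b"
  shows "(integral {0..sqrt (x * y)} f)\<^sup>2 \<le> integral {0..x} f * integral {0..y} f"
  using xy
proof (induction x y rule: linorder_wlog)
  case (le x y)
  then obtain l where l: "1 \<le> l" "l * x = sqrt (x * y)" "l * sqrt (x * y) = y"
    "x \<le> sqrt (x * y)" "sqrt (x * y) \<le> y"
    using geometric_mean_scaling by blast
  define z where "z = sqrt (x * y)"
  note l = l[folded z_def]
  have bound: "0 \<le> l * t" "l * t \<le> b" "t \<le> b" if "0 \<le> t" "t \<le> z" for t
    using that l le mult_left_mono[of t z l] by auto
  have scaled: "integral {0..x} (\<lambda>t. f (l * t)) = integral {0..z} f / l"
    "integral {0..z} (\<lambda>t. f (l * t)) = integral {0..y} f / l"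
    using l by (simp_all add: integral_scaled)
  \<comment> \<open>Now the inverse quotient \<open>f(t) / f(l t)\<close> decreases.\<close>
  have "integral {0..z} f * integral {0..x} (\<lambda>t. f (l * t))
      \<le> integral {0..x} f * integral {0..z} (\<lambda>t. f (l * t))"
  proof (rule integral_ratio_decreasing)
    show "continuous_on {0..z} f"
      by (rule continuous_on_subset[OF cf]) (use bound in auto)
    show "continuous_on {0..z} (\<lambda>t. f (l * t))"
      using bound by (intro continuous_on_compose2[OF cf]) (auto intro!: continuous_intros)
    show "f t * f (l * s) \<le> f s * f (l * t)" if "0 \<le> s" "s \<le> t" "t \<le> z" for s t
      using inc[OF l(1) that(1,2)] bound[of t] that by (simp add: mult.commute)
  qed (use l le f0 bound in \<open>auto simp: less_imp_le\<close>)
  then have "(integral {0..z} f)\<^sup>2 / l \<le> integral {0..x} f * integral {0..y} f / l"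
    unfolding scaled by (simp add: power2_eq_square mult.commute)
  then show ?case
    using l by (simp add: z_def[symmetric] divide_le_cancel)
next
  case (sym x y)
  then show ?case by (simp add: mult.commute)
qed

text \<open>The endpoint \<open>b\<close> is excluded from positivity and continuity so that the lemma covers the
  arcsine integrand, which is singular at \<open>b = 1\<close> and takes the default value \<open>0\<close> there.\<close>

lemma indefinite_integral_strict_mono:
  fixes f :: "real \<Rightarrow> real"
  assumes int: "f integrable_on {0..b}"
    and nonneg: "\<And>t. 0 \<le> t \<Longrightarrow> t \<le> b \<Longrightarrow> 0 \<le> f t"
    and pos: "\<And>t. 0 \<le> t \<Longrightarrow> t < b \<Longrightarrow> 0 < f t"
    and cont: "continuous_on {0..<b} f"
  shows "strict_mono_on {0..b} (\<lambda>x. integral {0..x} f)"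
proof (rule strict_mono_onI)
  fix x y assume xy: "x \<in> {0..b}" "y \<in> {0..b}" "x < y"
  define m where "m = (x + y) / 2"
  have m: "x < m" "m < y" using xy by (auto simp: m_def)
  have sub: "f integrable_on {c..d}" if "0 \<le> c" "d \<le> b" for c d
    using that by (intro integrable_on_subinterval[OF int]) auto
  have "integral {x..m} (\<lambda>_. 0) < integral {x..m} f"
    using xy m pos by (intro integral_less_real continuous_on_subset[OF cont]) auto
  also have "\<dots> \<le> integral {x..y} f"
    using xy m nonneg sub by (intro integral_subset_le) auto
  finally have "0 < integral {x..y} f" by simp
  moreover have "integral {0..x} f + integral {x..y} f = integral {0..y} f"
    using xy sub by (intro Henstock_Kurzweil_Integration.integral_combine) auto
  ultimately show "integral {0..x} f < integral {0..y} f" by linarith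
qed

lemma sqrt_mult_le_bound:
  fixes r s M :: real
  assumes "0 \<le> r" "r \<le> M" "0 \<le> s" "s \<le> M"
  shows "sqrt (r * s) \<le> M"
  using assms by (intro real_le_lsqrt) (auto simp: power2_eq_square intro: mult_mono)

section \<open>The generalized sine\<close>

abbreviation sin_density :: "real \<Rightarrow> real \<Rightarrow> real \<Rightarrow> real" where
  "sin_density p q t \<equiv> (1 - t powr q) powr (- (1 / p))"

lemma powr_lt_one:
  fixes t q :: real
  assumes "0 < q" "0 \<le> t" "t < 1"
  shows "t powr q < 1"
  using assms powr_less_mono2[of q t 1] by simp

lemma continuous_on_sin_density:
  assumes "1 < q"
  shows "continuous_on {0..<1} (sin_density p q)"
proof (intro continuous_on_powr' continuous_intros ballI conjI impI)
  fix t :: real assume "t \<in> {0..<1}"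
  hence "t powr q < 1" using assms powr_lt_one[of q t] by simp
  thus "0 \<le> 1 - t powr q" "1 - t powr q = 0 \<Longrightarrow> 0 < - (1 / p)" by simp_all
qed (use assms in auto)

text \<open>For \<open>S \<le> T\<close> and \<open>L \<ge> 1\<close>, the difference \<open>(1 - L S) (1 - T) - (1 - L T) (1 - S)\<close> equals
  \<open>(L - 1) (T - S)\<close>, and the exponent \<open>-1/p\<close> reverses the inequality.\<close>

lemma sin_density_scaling:
  assumes "1 < p" "1 < q" "1 \<le> l" "0 \<le> s" "s \<le> t" "l * t < 1"
  shows "sin_density p q (l * s) * sin_density p q t \<le> sin_density p q (l * t) * sin_density p q s"
proof -
  define S T L where "S = s powr q" and "T = t powr q" and "L = l powr q"
  have "s \<le> l * s" "t \<le> l * t" "l * s \<le> l * t" "0 \<le> l * s"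
    using assms mult_right_mono[of 1 l s] mult_right_mono[of 1 l t] by auto
  hence "l * s < 1" "s < 1" "t < 1"
    using assms(5,6) by linarith+
  hence lt: "S < 1" "T < 1" "L * S < 1" "L * T < 1"
    using assms(2-6) powr_lt_one[of q s] powr_lt_one[of q t] powr_lt_one[of q "l * s"]
      powr_lt_one[of q "l * t"]
    by (auto simp: S_def T_def L_def powr_mult)
  have "S \<le> T" "1 \<le> L"
    using assms by (auto simp: S_def T_def L_def intro!: powr_mono2 ge_one_powr_ge_zero)
  hence "0 \<le> (L - 1) * (T - S)" by simp
  hence "(1 - L * T) * (1 - S) \<le> (1 - L * S) * (1 - T)"
    by (simp add: algebra_simps)
  hence "((1 - L * S) * (1 - T)) powr (- (1 / p)) \<le> ((1 - L * T) * (1 - S)) powr (- (1 / p))"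
    using assms lt by (intro powr_mono2') auto
  thus ?thesis
    using assms lt by (simp add: S_def T_def L_def powr_mult)
qed

lemma sin_pq_geometric_mean:
  assumes p: "1 < p" and q: "1 < q"
    and r: "0 < r" "r < pi_pq p q / 2" and s: "0 < s" "s < pi_pq p q / 2"
  shows "sqrt (sin_pq p q r * sin_pq p q s) \<le> sin_pq p q (sqrt (r * s))"
proof -
  let ?f = "sin_density p q" and ?F = "arcsin_pq p q"
  have pi: "pi_pq p q / 2 = ?F 1" by (simp add: pi_pq_def arcsin_pq_def)
  have F0: "?F 0 = 0" by (simp add: arcsin_pq_def)
  \<comment> \<open>A divergent integral would have the default value \<open>0\<close>, contradicting \<open>0 < r < pi_pq p q / 2\<close>.\<close>
  have int: "?f integrable_on {0..1}"
    using r not_integrable_integral[of ?f "{0..1}"] by (auto simp: pi_pq_def)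
  have pos: "0 < ?f t" if "0 \<le> t" "t < 1" for t
    using powr_lt_one[of q t] that q by simp
  have mono: "strict_mono_on {0..1} ?F"
    unfolding arcsin_pq_def
    using int pos continuous_on_sin_density[OF q, of p]
    by (intro indefinite_integral_strict_mono) auto
  have cont: "continuous_on {0..1} ?F"
    unfolding arcsin_pq_def by (rule indefinite_integral_continuous_1[OF int])
  have inv: "sin_pq p q (?F u) = u" if "u \<in> {0..1}" for u
    unfolding sin_pq_def
    using the_inv_into_f_f[OF strict_mono_on_imp_inj_on[OF mono] that] .
  have surj: "\<exists>u. 0 < u \<and> u < 1 \<and> ?F u = c" if c: "0 < c" "c < ?F 1" for c
  proof -
    obtain u where "0 \<le> u" "u \<le> 1" "?F u = c"
      using IVT'[of ?F 0 c 1] c F0 cont by auto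
    thus ?thesis using c F0 by (intro exI[of _ u]) (auto simp: less_le)
  qed
  obtain x where x: "0 < x" "x < 1" "?F x = r" using surj r pi by auto
  obtain y where y: "0 < y" "y < 1" "?F y = s" using surj s pi by auto
  have "sqrt (r * s) < ?F 1"
    using sqrt_mult_le_bound[of r "max r s" s] r s pi by auto
  then obtain w where w: "0 < w" "w < 1" "?F w = sqrt (r * s)"
    using surj[of "sqrt (r * s)"] r s by auto
  define z where "z = sqrt (x * y)"
  have z: "z \<in> {0..1}"
    using sqrt_mult_le_bound[of x 1 y] x y by (auto simp: z_def)
  have "(integral {0..z} ?f)\<^sup>2 \<le> integral {0..x} ?f * integral {0..y} ?f"
    unfolding z_def
    using x y p q pos
    by (intro integral_geometric_mean_le[where b = "max x y"] sin_density_scaling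
        continuous_on_subset[OF continuous_on_sin_density[OF q]]) auto
  hence "(?F z)\<^sup>2 \<le> r * s"
    using x y by (simp add: arcsin_pq_def)
  hence "?F z \<le> ?F w"
    using w by (simp add: real_le_rsqrt)
  hence "z \<le> w"
    using strict_mono_onD[OF mono, of w z] w z by force
  thus ?thesis
    using inv[of x] inv[of y] inv[of w] x y w by (simp add: z_def)
qed

section \<open>The generalized hyperbolic sine\<close>

abbreviation sinh_density :: "real \<Rightarrow> real \<Rightarrow> real \<Rightarrow> real" where
  "sinh_density p q t \<equiv> (1 + t powr q) powr (- (1 / p))"

lemma sinh_density_pos: "0 < sinh_density p q t"
  using add_pos_nonneg[OF zero_less_one powr_ge_zero[of t q]]
  by (simp only: powr_gt_zero)

lemma continuous_on_sinh_density:
  assumes "1 < q" "A \<subseteq> {0..}"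
  shows "continuous_on A (sinh_density p q)"
proof (intro continuous_on_powr' continuous_intros ballI conjI impI)
  fix t assume "t \<in> A"
  show "0 \<le> 1 + t powr q" by (simp add: add_nonneg_nonneg)
  show "0 < - (1 / p)" if "1 + t powr q = 0"
    using that powr_ge_zero[of t q] by linarith
qed (use assms in auto)

text \<open>Here \<open>(1 + L T) (1 + S) - (1 + L S) (1 + T) = (L - 1) (T - S)\<close>, the opposite sign to the
  one for the sine.\<close>

lemma sinh_density_scaling:
  assumes "1 < p" "1 < q" "1 \<le> l" "0 \<le> s" "s \<le> t"
  shows "sinh_density p q (l * t) * sinh_density p q s \<le> sinh_density p q (l * s) * sinh_density p q t"
proof -
  define S T L where "S = s powr q" and "T = t powr q" and "L = l powr q"
  have ST: "0 \<le> S" "S \<le> T" "1 \<le> L"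
    using assms by (auto simp: S_def T_def L_def intro!: powr_mono2 ge_one_powr_ge_zero)
  hence "0 \<le> (L - 1) * (T - S)" by simp
  hence "(1 + L * S) * (1 + T) \<le> (1 + L * T) * (1 + S)"
    by (simp add: algebra_simps)
  moreover have "0 < (1 + L * S) * (1 + T)"
    using ST by (intro mult_pos_pos add_pos_nonneg) auto
  ultimately have "((1 + L * T) * (1 + S)) powr (- (1 / p)) \<le> ((1 + L * S) * (1 + T)) powr (- (1 / p))"
    using assms by (intro powr_mono2') auto
  thus ?thesis
    using assms ST by (simp add: S_def T_def L_def powr_mult)
qed

text \<open>By monotone convergence, \<open>mstar_pq\<close> is the supremum of the integrals over the intervals
  \<open>{0..n}\<close>.\<close>

lemma less_mstar_pq_imp_less_arcsinh_pq:
  assumes q: "1 < q" and r: "0 \<le> r" "ennreal r < mstar_pq p q"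
  obtains n :: nat where "r < arcsinh_pq p q (real n)"
proof -
  let ?f = "sinh_density p q"
  let ?g = "\<lambda>(n::nat) t. ennreal (?f t) * indicator {0..real n} t"
  have "(SUP n. ?g n t) = ennreal (?f t) * indicator {0..} t" for t :: real
  proof (cases "0 \<le> t")
    case True
    obtain n :: nat where n: "t \<le> real n" using real_arch_simple by blast
    show ?thesis
    proof (rule antisym)
      show "(SUP n. ?g n t) \<le> ennreal (?f t) * indicator {0..} t"
        by (intro SUP_least) (auto simp: indicator_def)
      show "ennreal (?f t) * indicator {0..} t \<le> (SUP n. ?g n t)"
        using True n by (intro SUP_upper2[of n]) (auto simp: indicator_def)
    qed
  qed (simp add: indicator_def)
  hence "mstar_pq p q = (\<integral>\<^sup>+t. (SUP n. ?g n t) \<partial>lborel)"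
    by (simp add: mstar_pq_def)
  also have "\<dots> = (SUP n. \<integral>\<^sup>+t. ?g n t \<partial>lborel)"
    by (intro nn_integral_monotone_convergence_SUP)
       (auto simp: incseq_def le_fun_def indicator_def)
  also have "\<dots> = (SUP n. ennreal (arcsinh_pq p q (real n)))"
  proof -
    have "(\<integral>\<^sup>+t. ?g n t \<partial>lborel) = ennreal (arcsinh_pq p q (real n))" for n
      unfolding arcsinh_pq_def
      by (intro nn_integral_has_integral_lebesgue' integrable_integral integrable_continuous_real
          continuous_on_sinh_density[OF q]) auto
    thus ?thesis by simp
  qed
  finally obtain n where "ennreal r < ennreal (arcsinh_pq p q (real n))"
    using r(2) by (auto simp: less_SUP_iff)
  hence "r < arcsinh_pq p q (real n)"
    using r(1) by (simp add: ennreal_less_iff)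
  thus ?thesis by (rule that)
qed

lemma sinh_pq_geometric_mean:
  assumes p: "1 < p" and q: "1 < q"
    and r: "0 < r" "ennreal r < mstar_pq p q" and s: "0 < s" "ennreal s < mstar_pq p q"
  shows "sinh_pq p q (sqrt (r * s)) \<le> sqrt (sinh_pq p q r * sinh_pq p q s)"
proof -
  let ?f = "sinh_density p q" and ?F = "arcsinh_pq p q"
  have F0: "?F 0 = 0" by (simp add: arcsinh_pq_def)
  have int: "?f integrable_on {0..b}" for b
    by (intro integrable_continuous_real continuous_on_sinh_density[OF q]) auto
  have "strict_mono_on {0..b} ?F" for b
    unfolding arcsinh_pq_def
    by (intro indefinite_integral_strict_mono continuous_on_sinh_density[OF q] int
        sinh_density_pos powr_ge_zero) auto
  hence mono: "strict_mono_on {0<..} ?F"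
    unfolding strict_mono_on_def by (metis atLeastAtMost_iff greaterThan_iff less_imp_le order_refl)
  have inv: "sinh_pq p q (?F u) = u" if "0 < u" for u
    unfolding sinh_pq_def
    using the_inv_into_f_f[OF strict_mono_on_imp_inj_on[OF mono], of u] that by simp
  have surj: "\<exists>u>0. ?F u = c" if c: "0 < c" "ennreal c < mstar_pq p q" for c
  proof -
    obtain n :: nat where "c < ?F (real n)"
      using less_mstar_pq_imp_less_arcsinh_pq[OF q less_imp_le[OF c(1)] c(2)] .
    moreover have "continuous_on {0..real n} ?F"
      unfolding arcsinh_pq_def by (rule indefinite_integral_continuous_1[OF int])
    ultimately obtain u where "0 \<le> u" "?F u = c"
      using IVT'[of ?F 0 c "real n"] c F0 by auto
    thus ?thesis using c F0 by (intro exI[of _ u]) (auto simp: less_le)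
  qed
  obtain x where x: "0 < x" "?F x = r" using surj r by auto
  obtain y where y: "0 < y" "?F y = s" using surj s by auto
  have "sqrt (r * s) \<le> max r s"
    using sqrt_mult_le_bound[of r "max r s" s] r s by auto
  moreover have "ennreal (max r s) < mstar_pq p q"
    using r s by (simp add: max_def)
  ultimately have "ennreal (sqrt (r * s)) < mstar_pq p q"
    by (rule le_less_trans[OF ennreal_leI])
  then obtain w where w: "0 < w" "?F w = sqrt (r * s)"
    using surj[of "sqrt (r * s)"] r s by auto
  define z where "z = sqrt (x * y)"
  have z: "0 < z" using x y by (simp add: z_def)
  have "integral {0..x} ?f * integral {0..y} ?f \<le> (integral {0..z} ?f)\<^sup>2"
    unfolding z_def
    using x y p q sinh_density_pos
    by (intro integral_geometric_mean_ge[where b = "max x y"] sinh_density_scaling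
        continuous_on_sinh_density) auto
  hence "r * s \<le> (?F z)\<^sup>2"
    using x y by (simp add: arcsinh_pq_def)
  moreover have "0 \<le> ?F z"
    unfolding arcsinh_pq_def by (intro integral_nonneg int) auto
  ultimately have "?F w \<le> ?F z"
    using w by (simp add: real_le_lsqrt)
  hence "w \<le> z"
    using strict_mono_onD[OF mono, of z w] w z by force
  thus ?thesis
    using inv[of x] inv[of y] inv[of w] x y w by (simp add: z_def)
qed

section \<open>The geometric mean inequalities\<close>

theorem theorem1p1:
  fixes p q :: real
  assumes "p > 1" and "q > 1"
  shows "(\<forall>r\<in>{0<..<pi_pq p q / 2}. \<forall>s\<in>{0<..<pi_pq p q / 2}.
            sin_pq p q (sqrt (r * s)) \<ge> sqrt (sin_pq p q r * sin_pq p q s)) \<and>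
         (\<forall>r s :: real. 0 < r \<longrightarrow> ennreal r < mstar_pq p q \<longrightarrow>
            0 < s \<longrightarrow> ennreal s < mstar_pq p q \<longrightarrow>
            sinh_pq p q (sqrt (r * s)) \<le> sqrt (sinh_pq p q r * sinh_pq p q s))"
  using sin_pq_geometric_mean[OF assms] sinh_pq_geometric_mean[OF assms] by auto

end
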